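(* Let $k>2$ be a fixed integer and suppose that $m=m(n)\gg n^k$. Then $$\mathrm{satex}(n,\,P_{k+1}:\,m,\,C_{2k})\ \ge\ \left(\frac1k-o(1)\right)\left(\frac{m}{n}\right)^2.$$
   Context: All graphs are finite and simple. $P_{k+1}$ denotes the path on $k+1$ vertices (of length $k$) and $C_{2k}$ the cycle on $2k$ vertices. A copy of a graph is a (not necessarily induced) subgraph isomorphic to it. $\mathrm{satex}(n,F:m,G)$ denotes the minimum number of copies of $G$ in an $n$-vertex graph having at least $m$ copies of $F$ (considered when such a graph exists). $f(n)\gg g(n)$ means $f(n)/g(n)\to\infty$ as $n\to\infty$; $o(1)$ is for $n\to\infty$ with $k$ fixed. *)

theory Defs
  imports "HOL-Library.Landau_Symbols"
begin

type_synonym 'a sgraph = "'a set \<times> 'a set set"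

abbreviation verts :: "'a sgraph \<Rightarrow> 'a set" where
  "verts G \<equiv> fst G"

abbreviation edges :: "'a sgraph \<Rightarrow> 'a set set" where
  "edges G \<equiv> snd G"

definition simple_graph :: "'a sgraph \<Rightarrow> bool" where
  "simple_graph G \<longleftrightarrow> finite (verts G) \<and> (\<forall>e\<in>edges G. e \<subseteq> verts G \<and> card e = 2)"

definition subgraph :: "'a sgraph \<Rightarrow> 'a sgraph \<Rightarrow> bool" where
  "subgraph H G \<longleftrightarrow> simple_graph H \<and> verts H \<subseteq> verts G \<and> edges H \<subseteq> edges G"

definition isomorphic :: "'a sgraph \<Rightarrow> 'b sgraph \<Rightarrow> bool" where
  "isomorphic G H \<longleftrightarrow>
     (\<exists>f. bij_betw f (verts G) (verts H) \<and>
          (\<forall>u\<in>verts G. \<forall>v\<in>verts G. {u, v} \<in> edges G \<longleftrightarrow> {f u, f v} \<in> edges H))"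

text \<open>Copies are unlabelled: each subgraph of \<open>H\<close> isomorphic to \<open>F\<close> counts once.\<close>

definition copies :: "'a sgraph \<Rightarrow> 'b sgraph \<Rightarrow> 'b sgraph set" where
  "copies F H = {S. subgraph S H \<and> isomorphic F S}"

definition num_copies :: "'a sgraph \<Rightarrow> 'b sgraph \<Rightarrow> nat" where
  "num_copies F H = card (copies F H)"

text \<open>The path and the cycle are indexed by their number of vertices; \<open>cycle_graph n\<close> is
  a cycle for \<open>n \<ge> 3\<close> only.\<close>

definition path_graph :: "nat \<Rightarrow> nat sgraph" where
  "path_graph n = ({..<n}, {{i, Suc i} | i. Suc i < n})"

definition cycle_graph :: "nat \<Rightarrow> nat sgraph" where
  "cycle_graph n = ({..<n}, {{i, Suc i mod n} | i. i < n})"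

text \<open>Every finite graph is isomorphic to one whose vertices are natural numbers, so the
  host graphs are taken over \<^typ>\<open>nat\<close>.\<close>

definition satex_hosts :: "nat \<Rightarrow> 'a sgraph \<Rightarrow> nat \<Rightarrow> nat sgraph set" where
  "satex_hosts n F m = {H. simple_graph H \<and> card (verts H) = n \<and> m \<le> num_copies F H}"

text \<open>A nonempty set of natural numbers attains its infimum, so this is a minimum whenever
  \<^term>\<open>satex_hosts n F m\<close> is nonempty. Otherwise the value is meaningless.\<close>

definition satex :: "nat \<Rightarrow> 'a sgraph \<Rightarrow> nat \<Rightarrow> 'b sgraph \<Rightarrow> nat" where
  "satex n F m G = (INF H \<in> satex_hosts n F m. num_copies G H)"

lemma simple_graph_path_graph: "simple_graph (path_graph n)"
  by (auto simp: simple_graph_def path_graph_def card_insert_if)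

lemma simple_graph_cycle_graph:
  assumes "n \<ge> 3"
  shows "simple_graph (cycle_graph n)"
  using assms by (auto simp: simple_graph_def cycle_graph_def card_insert_if mod_Suc)

lemma satex_attained:
  assumes "satex_hosts n F m \<noteq> {}"
  shows "\<exists>H\<in>satex_hosts n F m. satex n F m G = num_copies G H"
  using Inf_nat_def1[of "num_copies G ` satex_hosts n F m"] assms
  by (auto simp: satex_def)

end

theory Submission
  imports Defs "HOL-Analysis.Convex"
begin

text \<open>
  Count pairs of paths instead of cycles. Let \<open>w\<close> be the number of paths of length \<open>k\<close> written as
  vertex lists, so that each copy of \<open>P\<^bsub>k+1\<^esub>\<close> contributes two lists and \<open>w \<ge> 2 m\<close>
  (\<open>two_num_copies_path_le\<close>). Sort the lists by their ordered pair of ends. There are at most \<open>n\<^sup>2\<close>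
  classes, so by the Cauchy--Schwarz inequality (\<open>card_squared_le_card_collisions\<close>) there are at
  least \<open>w\<^sup>2 / n\<^sup>2\<close> ordered pairs of lists with the same ends.

  If two such paths share no inner vertex, going along the first and back along the second is a cycle
  of length \<open>2 k\<close>, and the pair can be read off from the resulting vertex list
  (\<open>card_noncrossing_le\<close>). As a cycle has \<open>4 k\<close> vertex lists (\<open>2 k\<close> starting points and two
  directions, \<open>card_cycle_lists_le\<close>), the number of cycles is at least the number of
  disjoint pairs divided by \<open>4 k\<close>.

  The pairs that do share an inner vertex are negligible, and this is where \<open>m \<gg> n\<^sup>k\<close> enters. For a
  fixed first path, the second one has both ends and one inner vertex prescribed. There are at most
  \<open>k\<^sup>2\<close> ways to choose the two positions of the shared vertex, and then at most \<open>n\<^bsup>k-2\<^esup>\<close> paths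
  (\<open>card_crossing_le\<close>). Hence at most \<open>k\<^sup>2 n\<^bsup>k-2\<^esup> w\<close> pairs are lost, against
  \<open>w\<^sup>2 / n\<^sup>2\<close> in total: a proportion of \<open>k\<^sup>2 n\<^sup>k / w\<close>, which tends to \<open>0\<close>. What remains is
  \<open>(1 / (4 k)) (2 m / n)\<^sup>2 = (1 / k) (m / n)\<^sup>2\<close> up to the factor \<open>1 - k\<^sup>2 n\<^sup>k / (2 m)\<close>.
\<close>

section \<open>Subgraphs as images\<close>

text \<open>
  The image of a graph on an initial segment of the natural numbers when vertex \<open>i\<close> is put at the
  \<open>i\<close>-th entry of a list. It turns a vertex list into the unlabelled path or cycle that it traverses.
\<close>

definition place :: "nat sgraph \<Rightarrow> 'a list \<Rightarrow> 'a sgraph" where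
  "place F xs = ((!) xs ` verts F, (`) ((!) xs) ` edges F)"

text \<open>
  Isomorphism is given by an equivalence about pairs \<open>{u, v}\<close>. Since edges have exactly two elements,
  all of which are vertices, it amounts to the edge sets being images of each other.
\<close>

lemma isomorphicE:
  assumes "isomorphic F S" "simple_graph F" "simple_graph S"
  obtains f where "bij_betw f (verts F) (verts S)" "edges S = (`) f ` edges F"
proof -
  obtain f where f: "bij_betw f (verts F) (verts S)"
    and edge_iff: "\<And>u v. u \<in> verts F \<Longrightarrow> v \<in> verts F \<Longrightarrow> {u, v} \<in> edges F \<longleftrightarrow> {f u, f v} \<in> edges S"
    using assms(1) unfolding isomorphic_def by blast
  have "edges S = (`) f ` edges F"
  proof (intro equalityI subsetI)
    fix e assume e: "e \<in> edges S"
    then have "card e = 2" "e \<subseteq> f ` verts F"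
      using assms(3) f by (auto simp: simple_graph_def bij_betw_def)
    then obtain u v where "u \<in> verts F" "v \<in> verts F" "e = {f u, f v}"
      by (auto simp: card_2_iff)
    then show "e \<in> (`) f ` edges F"
      using e edge_iff[of u v] by (auto intro!: image_eqI[of _ _ "{u, v}"])
  next
    fix e assume "e \<in> (`) f ` edges F"
    then obtain d where d: "d \<in> edges F" "e = f ` d" by blast
    then have "card d = 2" "d \<subseteq> verts F"
      using assms(2) by (auto simp: simple_graph_def)
    then obtain u v where "u \<in> verts F" "v \<in> verts F" "d = {u, v}"
      by (auto simp: card_2_iff)
    then show "e \<in> edges S" using d edge_iff[of u v] by auto
  qed
  with f show ?thesis by (rule that)
qed

lemma isomorphic_image:
  assumes "simple_graph F" "inj_on f (verts F)"
  shows "isomorphic F (f ` verts F, (`) f ` edges F)"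
proof -
  have "{u, v} \<in> edges F" if uv: "u \<in> verts F" "v \<in> verts F" "{f u, f v} \<in> (`) f ` edges F" for u v
  proof -
    obtain d where d: "d \<in> edges F" "f ` {u, v} = f ` d"
      using uv(3) by (metis (no_types, lifting) imageE image_empty image_insert)
    have "d \<subseteq> verts F" using assms(1) d(1) by (auto simp: simple_graph_def)
    then have "{u, v} = d"
      using inj_on_image_eq_iff[OF assms(2), of "{u, v}" d] uv(1,2) d(2) by blast
    then show ?thesis using d(1) by simp
  qed
  moreover have "{f u, f v} \<in> (`) f ` edges F" if "{u, v} \<in> edges F" for u v
    using that by (auto intro!: image_eqI[of _ _ "{u, v}"])
  ultimately show ?thesis
    unfolding isomorphic_def using assms(2)
    by (intro exI[of _ f]) (auto simp: bij_betw_def)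
qed

lemma finite_copies:
  assumes "simple_graph G"
  shows "finite (copies F G)"
proof -
  have "finite (verts G)" "edges G \<subseteq> Pow (verts G)"
    using assms by (auto simp: simple_graph_def)
  then have "finite (Pow (verts G) \<times> Pow (edges G))"
    by (auto intro: finite_subset)
  moreover have "copies F G \<subseteq> Pow (verts G) \<times> Pow (edges G)"
    by (auto simp: copies_def subgraph_def)
  ultimately show ?thesis by (rule finite_subset[rotated])
qed

section \<open>Paths and cycles as vertex lists\<close>

definition path_lists :: "'a sgraph \<Rightarrow> nat \<Rightarrow> 'a list set" where
  "path_lists G n = {xs. length xs = n \<and> distinct xs \<and> set xs \<subseteq> verts G \<and>
     successively (\<lambda>u v. {u, v} \<in> edges G) xs}"

definition cycle_lists :: "'a sgraph \<Rightarrow> nat \<Rightarrow> 'a list set" where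
  "cycle_lists G n = {xs \<in> path_lists G n. {last xs, hd xs} \<in> edges G}"

lemma finite_path_lists:
  assumes "simple_graph G"
  shows "finite (path_lists G n)"
proof -
  have "finite {xs. set xs \<subseteq> verts G \<and> length xs = n}"
    using assms by (intro finite_lists_length_eq) (simp add: simple_graph_def)
  then show ?thesis by (rule finite_subset[rotated]) (auto simp: path_lists_def)
qed

lemma finite_cycle_lists:
  assumes "simple_graph G"
  shows "finite (cycle_lists G n)"
  using finite_path_lists[OF assms] by (simp add: cycle_lists_def)

lemma rev_path_lists: "xs \<in> path_lists G n \<Longrightarrow> rev xs \<in> path_lists G n"
  by (auto simp: path_lists_def insert_commute)

text \<open>
  A path copy is traversed by a list and by its reversal, which is the source of the factor \<open>2\<close> below.
\<close>

lemma place_rev: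
  assumes "length xs = n"
  shows "place (path_graph n) (rev xs) = place (path_graph n) xs"
proof -
  have sub: "edges (place (path_graph n) (rev ys)) \<subseteq> edges (place (path_graph n) ys)"
    if "length ys = n" for ys :: "'a list"
  proof
    fix e assume "e \<in> edges (place (path_graph n) (rev ys))"
    then obtain i where i: "Suc i < n" "e = {rev ys ! i, rev ys ! Suc i}"
      by (auto simp: place_def path_graph_def)
    define j where "j = n - Suc (Suc i)"
    have "e = (!) ys ` {j, Suc j}"
      using i that by (auto simp: rev_nth j_def Suc_diff_Suc)
    moreover have "{j, Suc j} \<in> edges (path_graph n)"
      using i by (auto simp: path_graph_def j_def)
    ultimately show "e \<in> edges (place (path_graph n) ys)"
      unfolding place_def snd_conv by (metis imageI)
  qed
  have "edges (place (path_graph n) (rev xs)) = edges (place (path_graph n) xs)"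
    using sub[of xs] sub[of "rev xs"] assms by auto
  moreover have "verts (place (path_graph n) ys) = set ys" if "length ys = n" for ys :: "'a list"
    using that by (auto simp: place_def path_graph_def set_conv_nth)
  ultimately show ?thesis using assms by (intro prod_eqI) auto
qed

lemma path_copy_listed:
  assumes "S \<in> copies (path_graph n) G"
  shows "\<exists>xs\<in>path_lists G n. place (path_graph n) xs = S"
proof -
  have S: "simple_graph S" "verts S \<subseteq> verts G" "edges S \<subseteq> edges G" "isomorphic (path_graph n) S"
    using assms by (auto simp: copies_def subgraph_def)
  obtain f where f: "bij_betw f {..<n} (verts S)" "edges S = (`) f ` edges (path_graph n)"
    using isomorphicE[OF S(4) simple_graph_path_graph S(1)] by (auto simp: path_graph_def)
  define xs where "xs = map f [0..<n]"
  have "place (path_graph n) xs = S"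
  proof (intro prod_eqI)
    show "verts (place (path_graph n) xs) = verts S"
      using f(1) by (auto simp: place_def path_graph_def xs_def bij_betw_def)
    have "(!) xs ` d = f ` d" if "d \<in> edges (path_graph n)" for d
      using that by (auto simp: path_graph_def xs_def)
    then show "edges (place (path_graph n) xs) = edges S"
      by (simp add: place_def f(2))
  qed
  moreover have "{f i, f (Suc i)} \<in> edges G" if "Suc i < n" for i
  proof -
    have "f ` {i, Suc i} \<in> edges S"
      unfolding f(2) using that by (intro imageI) (auto simp: path_graph_def)
    then show ?thesis using S(3) by auto
  qed
  then have "successively (\<lambda>u v. {u, v} \<in> edges G) xs"
    by (auto simp: successively_conv_nth xs_def)
  then have "xs \<in> path_lists G n"
    using f(1) S(2) by (auto simp: path_lists_def xs_def bij_betw_def distinct_map atLeast0LessThan)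
  ultimately show ?thesis by blast
qed

text \<open>
  Choosing one list for each copy and adding all the reversals gives no list twice: a list determines
  its copy, and a list of at least two distinct vertices differs from its reversal.
\<close>

lemma two_num_copies_path_le:
  assumes "simple_graph G" "n \<ge> 2"
  shows "2 * num_copies (path_graph n) G \<le> card (path_lists G n)"
proof -
  let ?C = "copies (path_graph n) G"
  have "\<forall>S\<in>?C. \<exists>xs. xs \<in> path_lists G n \<and> place (path_graph n) xs = S"
    using path_copy_listed by blast
  from bchoice[OF this] obtain g where
    "\<forall>S\<in>?C. g S \<in> path_lists G n \<and> place (path_graph n) (g S) = S" ..
  then have g: "g S \<in> path_lists G n" "place (path_graph n) (g S) = S" if "S \<in> ?C" for S
    using that by blast+
  have len: "length (g S) = n" "distinct (g S)" if "S \<in> ?C" for S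
    using g(1)[OF that] by (auto simp: path_lists_def)
  have rev_g: "place (path_graph n) (rev (g S)) = S" if "S \<in> ?C" for S
    using g(2)[OF that] place_rev[OF len(1)[OF that]] by simp
  have inj: "inj_on g ?C" "inj_on (\<lambda>S. rev (g S)) ?C"
  proof -
    show "inj_on g ?C"
    proof (rule inj_onI)
      fix S T assume S: "S \<in> ?C" "T \<in> ?C" "g S = g T"
      have "place (path_graph n) (g T) = S" using g(2)[OF S(1)] unfolding S(3) .
      then show "S = T" using g(2)[OF S(2)] by (rule trans[OF sym])
    qed
    then have "inj_on (rev \<circ> g) ?C" by (rule comp_inj_on) simp
    then show "inj_on (\<lambda>S. rev (g S)) ?C" by (simp only: o_def)
  qed
  \<comment> \<open>A list that equals its reversal has equal first and last entries.\<close>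
  have disj: "g ` ?C \<inter> (\<lambda>S. rev (g S)) ` ?C = {}"
  proof -
    have False if S: "S \<in> ?C" "T \<in> ?C" "g S = rev (g T)" for S T
    proof -
      have "place (path_graph n) (rev (g T)) = S"
        using g(2)[OF S(1)] unfolding S(3) .
      then have "S = T" using rev_g[OF S(2)] by (rule trans[OF sym])
      then have eq: "rev (g T) = g T"
        using S(3)[symmetric] by (rule back_subst[of "\<lambda>U. rev (g T) = g U", rotated])
      have "rev (g T) ! 0 = g T ! (n - 1)"
        using len(1)[OF S(2)] assms(2) by (subst rev_nth) auto
      then have "g T ! 0 = g T ! (n - 1)" unfolding eq .
      then show False
        using len[OF S(2)] assms(2) nth_eq_iff_index_eq[of "g T" 0 "n - 1"] by simp
    qed
    then show ?thesis by blast
  qed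
  have "card (g ` ?C \<union> (\<lambda>S. rev (g S)) ` ?C) = card (g ` ?C) + card ((\<lambda>S. rev (g S)) ` ?C)"
    by (intro card_Un_disjoint finite_imageI finite_copies assms(1) disj)
  then have "2 * card ?C = card (g ` ?C \<union> (\<lambda>S. rev (g S)) ` ?C)"
    unfolding card_image[OF inj(1)] card_image[OF inj(2)] by simp
  also have "\<dots> \<le> card (path_lists G n)"
  proof (rule card_mono[OF finite_path_lists[OF assms(1)]])
    show "g ` ?C \<union> (\<lambda>S. rev (g S)) ` ?C \<subseteq> path_lists G n"
      by (intro Un_least image_subsetI rev_path_lists g(1))
  qed
  finally show ?thesis by (simp add: num_copies_def)
qed

lemma edges_place_cycle:
  "edges (place (cycle_graph n) xs) = {{xs ! i, xs ! (Suc i mod n)} | i. i < n}"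
proof -
  have "edges (cycle_graph n) = (\<lambda>i. {i, Suc i mod n}) ` {..<n}"
    by (auto simp: cycle_graph_def)
  then have "edges (place (cycle_graph n) xs) = (\<lambda>i. {xs ! i, xs ! (Suc i mod n)}) ` {..<n}"
    by (simp add: place_def image_image)
  then show ?thesis by auto
qed

lemma cycle_lists_edge:
  assumes "xs \<in> cycle_lists G n" "i < n"
  shows "{xs ! i, xs ! (Suc i mod n)} \<in> edges G"
proof (cases "Suc i = n")
  case True
  moreover have "length xs = n" "{last xs, hd xs} \<in> edges G" "xs \<noteq> []"
    using assms by (auto simp: cycle_lists_def path_lists_def)
  ultimately show ?thesis by (auto simp: hd_conv_nth last_conv_nth)
next
  case False
  then show ?thesis
    using assms by (auto simp: cycle_lists_def path_lists_def successively_conv_nth)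
qed

lemma place_cycle_in_copies:
  assumes "simple_graph G" "xs \<in> cycle_lists G n" "n \<ge> 3"
  shows "place (cycle_graph n) xs \<in> copies (cycle_graph n) G"
proof -
  have xs: "length xs = n" "distinct xs" "set xs \<subseteq> verts G"
    using assms(2) by (auto simp: cycle_lists_def path_lists_def)
  have "inj_on ((!) xs) (verts (cycle_graph n))"
    using xs by (auto simp: cycle_graph_def inj_on_def nth_eq_iff_index_eq)
  then have iso: "isomorphic (cycle_graph n) (place (cycle_graph n) xs)"
    unfolding place_def by (intro isomorphic_image simple_graph_cycle_graph assms(3))
  have verts: "verts (place (cycle_graph n) xs) = set xs"
    using xs(1) by (auto simp: place_def cycle_graph_def set_conv_nth)
  have "edges (place (cycle_graph n) xs) \<subseteq> edges G"
    using cycle_lists_edge[OF assms(2)] by (auto simp: edges_place_cycle)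
  moreover have "e \<subseteq> set xs" if "e \<in> edges (place (cycle_graph n) xs)" for e
    using that xs(1) assms(3) by (auto simp: edges_place_cycle intro!: nth_mem mod_less_divisor)
  ultimately have "subgraph (place (cycle_graph n) xs) G"
    using assms(1) xs(3) verts by (auto simp: subgraph_def simple_graph_def)
  with iso show ?thesis by (simp add: copies_def)
qed

text \<open>
  In a cycle, each vertex has just two neighbours, so the vertex that follows \<open>a, b\<close> on a traversal is
  the neighbour of \<open>b\<close> other than \<open>a\<close>. The first two entries therefore determine the whole traversal.
\<close>

lemma cycle_list_unique:
  assumes "distinct xs" "length xs = n" "distinct ys" "length ys = n" "n \<ge> 3"
    and same: "place (cycle_graph n) xs = place (cycle_graph n) ys"
    and start: "xs ! 0 = ys ! 0" "xs ! 1 = ys ! 1"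
  shows "xs = ys"
proof -
  have step: "Suc i < n \<longrightarrow> xs ! i = ys ! i \<and> xs ! Suc i = ys ! Suc i" for i
  proof (induction i)
    case 0
    then show ?case using start by simp
  next
    case (Suc i)
    show ?case
    proof
      assume i: "Suc (Suc i) < n"
      then have eq: "xs ! i = ys ! i" "xs ! Suc i = ys ! Suc i" using Suc by auto
      have "{xs ! Suc i, xs ! Suc (Suc i)} \<in> edges (place (cycle_graph n) xs)"
        using i by (auto simp: edges_place_cycle intro!: exI[of _ "Suc i"])
      then obtain j where j: "j < n"
          "{xs ! Suc i, xs ! Suc (Suc i)} = {ys ! j, ys ! (Suc j mod n)}"
        unfolding same edges_place_cycle by blast
      have ne: "xs ! Suc (Suc i) \<noteq> ys ! i"
        using i assms eq by (metis Suc_lessD n_not_Suc_n nth_eq_iff_index_eq lessI less_SucI less_irrefl)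
      consider "ys ! Suc i = ys ! j" "xs ! Suc (Suc i) = ys ! (Suc j mod n)"
        | "ys ! Suc i = ys ! (Suc j mod n)" "xs ! Suc (Suc i) = ys ! j"
        using j(2) eq by (auto simp: doubleton_eq_iff)
      then have "xs ! Suc (Suc i) = ys ! Suc (Suc i)"
      proof cases
        case 1
        then have "j = Suc i" using j(1) i assms by (simp add: nth_eq_iff_index_eq)
        then show ?thesis using 1 i by simp
      next
        case 2
        then have "Suc i = Suc j mod n" using j(1) i assms by (simp add: nth_eq_iff_index_eq)
        then have "j = i" using j(1) by (auto simp: mod_Suc split: if_splits)
        then show ?thesis using 2 ne by simp
      qed
      then show "xs ! Suc i = ys ! Suc i \<and> xs ! Suc (Suc i) = ys ! Suc (Suc i)"
        using eq by simp
    qed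
  qed
  show ?thesis
  proof (rule nth_equalityI)
    fix i assume "i < length xs"
    then show "xs ! i = ys ! i"
      using step[of i] step[of "i - 1"] assms(2,5) by (cases "Suc i = n") auto
  qed (use assms in simp)
qed

text \<open>
  A traversal of \<open>S\<close> is determined by its first two entries, and these form one of the \<open>n\<close> edges of
  \<open>S\<close> in one of two orders.
\<close>

lemma card_cycle_lists_of_copy_le:
  assumes "n \<ge> 3"
  shows "card {xs \<in> cycle_lists G n. place (cycle_graph n) xs = S} \<le> 2 * n"
proof (cases "{xs \<in> cycle_lists G n. place (cycle_graph n) xs = S} = {}")
  case False
  let ?L = "{xs \<in> cycle_lists G n. place (cycle_graph n) xs = S}"
  obtain zs where zs: "zs \<in> ?L" using False by blast
  \<comment> \<open>The edges of the copy, each directed along one fixed traversal of it.\<close>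
  define A where "A = (\<lambda>i. (zs ! i, zs ! (Suc i mod n))) ` {..<n}"
  have "card A \<le> n" "finite A"
    using card_image_le[of "{..<n}"] by (simp_all add: A_def)
  have L: "length xs = n" "distinct xs" if "xs \<in> ?L" for xs
    using that by (auto simp: cycle_lists_def path_lists_def)
  have "inj_on (\<lambda>xs. (xs ! 0, xs ! 1)) ?L"
  proof (rule inj_onI)
    fix xs ys assume *: "xs \<in> ?L" "ys \<in> ?L" "(xs ! 0, xs ! 1) = (ys ! 0, ys ! 1)"
    then have "place (cycle_graph n) xs = place (cycle_graph n) ys" by simp
    then show "xs = ys"
      using * L[OF *(1)] L[OF *(2)] assms by (intro cycle_list_unique[where n = n]) auto
  qed
  then have "card ?L = card ((\<lambda>xs. (xs ! 0, xs ! 1)) ` ?L)"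
    by (simp add: card_image)
  also have "\<dots> \<le> card (A \<union> prod.swap ` A)"
  proof (intro card_mono subsetI)
    fix p assume "p \<in> (\<lambda>xs. (xs ! 0, xs ! 1)) ` ?L"
    then obtain xs where xs: "xs \<in> ?L" "p = (xs ! 0, xs ! 1)" by blast
    have "{xs ! 0, xs ! 1} \<in> edges (place (cycle_graph n) xs)"
      using assms by (auto simp: edges_place_cycle intro!: exI[of _ 0])
    also have "place (cycle_graph n) xs = place (cycle_graph n) zs"
      using xs zs by simp
    finally obtain i where "i < n" "{xs ! 0, xs ! 1} = {zs ! i, zs ! (Suc i mod n)}"
      unfolding edges_place_cycle by blast
    then show "p \<in> A \<union> prod.swap ` A"
      using xs(2) by (auto simp: A_def doubleton_eq_iff image_image)
  qed (use \<open>finite A\<close> in auto)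
  also have "\<dots> \<le> card A + card (prod.swap ` A)" by (rule card_Un_le)
  also have "\<dots> \<le> 2 * n"
    using \<open>card A \<le> n\<close> card_image_le[OF \<open>finite A\<close>, of prod.swap] by linarith
  finally show ?thesis .
next
  case True
  then show ?thesis by (metis card.empty zero_le)
qed

lemma card_cycle_lists_le:
  assumes "simple_graph G" "n \<ge> 3"
  shows "card (cycle_lists G n) \<le> 2 * n * num_copies (cycle_graph n) G"
proof -
  let ?C = "copies (cycle_graph n) G"
  have "cycle_lists G n = (\<Union>S\<in>?C. {xs \<in> cycle_lists G n. place (cycle_graph n) xs = S})"
    using place_cycle_in_copies[OF assms(1) _ assms(2)] by auto
  then have "card (cycle_lists G n)
      \<le> (\<Sum>S\<in>?C. card {xs \<in> cycle_lists G n. place (cycle_graph n) xs = S})"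
    using card_UN_le[OF finite_copies[OF assms(1)],
        of "\<lambda>S. {xs \<in> cycle_lists G n. place (cycle_graph n) xs = S}" "cycle_graph n"] by simp
  also have "\<dots> \<le> (\<Sum>S\<in>?C. 2 * n)"
    by (intro sum_mono card_cycle_lists_of_copy_le assms(2))
  finally show ?thesis by (simp add: num_copies_def mult.commute)
qed

section \<open>Pairs of paths with common ends\<close>

text \<open>
  The Cauchy--Schwarz inequality for the sizes of the fibres of \<open>f\<close>: their sum is the size of \<open>A\<close>, and
  the sum of their squares is the number of pairs that \<open>f\<close> identifies.
\<close>

lemma card_squared_le_card_collisions:
  assumes "finite A" "finite B" "f ` A \<subseteq> B"
  shows "(card A)\<^sup>2 \<le> card B * card {(a, a') \<in> A \<times> A. f a = f a'}"
proof -
  let ?x = "\<lambda>b. card {a \<in> A. f a = b}"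
  have "card {(a, a') \<in> A \<times> A. f a = f a'} = card (\<Union>b\<in>B. {a \<in> A. f a = b} \<times> {a \<in> A. f a = b})"
    using assms(3) by (intro arg_cong[of _ _ card]) auto
  also have "\<dots> = (\<Sum>b\<in>B. (?x b)\<^sup>2)"
    using assms by (subst card_UN_disjoint) (auto simp: card_cartesian_product power2_eq_square)
  finally have pairs: "card {(a, a') \<in> A \<times> A. f a = f a'} = (\<Sum>b\<in>B. (?x b)\<^sup>2)" .
  have "card A = card (\<Union>b\<in>B. {a \<in> A. f a = b})"
    using assms(3) by (intro arg_cong[of _ _ card]) auto
  also have "\<dots> = (\<Sum>b\<in>B. ?x b)"
    using assms by (subst card_UN_disjoint) auto
  finally have "(real (card A))\<^sup>2 = (\<Sum>b\<in>B. real (?x b))\<^sup>2" by simp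
  also have "\<dots> \<le> (\<Sum>b\<in>B. (real (?x b))\<^sup>2) * real (card B)"
    by (rule sum_squared_le_sum_of_squares)
  also have "\<dots> = real (card B * card {(a, a') \<in> A \<times> A. f a = f a'})"
    unfolding pairs of_nat_mult of_nat_sum of_nat_power by (rule mult.commute)
  finally show ?thesis unfolding of_nat_power[symmetric] of_nat_le_iff .
qed

text \<open>
  Of the \<open>k + 1\<close> entries, those at the three distinct positions \<open>0\<close>, \<open>j\<close> and \<open>k\<close> are fixed, which
  leaves \<open>k - 2\<close> free ones.
\<close>

lemma card_lists_three_prescribed_le:
  assumes "finite V" "0 < j" "j < k"
  shows "card {ys. length ys = Suc k \<and> set ys \<subseteq> V \<and> ys ! 0 = a \<and> ys ! j = b \<and> ys ! k = c}
    \<le> card V ^ (k - 2)"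
proof -
  let ?L = "{ys. length ys = Suc k \<and> set ys \<subseteq> V \<and> ys ! 0 = a \<and> ys ! j = b \<and> ys ! k = c}"
  let ?I = "{..k} - {0, j, k}"
  have "card ?L \<le> card (?I \<rightarrow>\<^sub>E V)"
  proof (rule card_inj_on_le)
    show "inj_on (\<lambda>ys. restrict ((!) ys) ?I) ?L"
    proof (rule inj_onI, rule nth_equalityI)
      fix xs ys i
      assume *: "xs \<in> ?L" "ys \<in> ?L" "restrict ((!) xs) ?I = restrict ((!) ys) ?I"
        and "i < length xs"
      then show "xs ! i = ys ! i"
        using *(1,2) restrict_apply'[of i ?I "(!) xs"] restrict_apply'[of i ?I "(!) ys"]
        by (cases "i \<in> ?I") (simp only: *(3), auto)
    qed auto
    show "(\<lambda>ys. restrict ((!) ys) ?I) ` ?L \<subseteq> ?I \<rightarrow>\<^sub>E V"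
    proof (intro image_subsetI)
      fix ys assume "ys \<in> ?L"
      then have "\<forall>i\<in>?I. ys ! i \<in> V" by (auto simp: subset_iff)
      then show "restrict ((!) ys) ?I \<in> ?I \<rightarrow>\<^sub>E V" by (simp only: restrict_PiE_iff)
    qed
  qed (use assms in \<open>auto intro!: finite_PiE\<close>)
  also have "\<dots> = card V ^ card ?I" by (simp add: card_PiE)
  also have "card ?I = k - 2"
    using assms by (subst card_Diff_subset) auto
  finally show ?thesis .
qed

text \<open>
  Only inner vertices are compared, because the paths in question share their ends anyway.
\<close>

definition crossing :: "'a list \<Rightarrow> 'a list \<Rightarrow> bool" where
  "crossing xs ys \<longleftrightarrow> set (tl (butlast xs)) \<inter> set (tl (butlast ys)) \<noteq> {}"

lemma set_tl_butlast:
  assumes "length xs = Suc k"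
  shows "set (tl (butlast xs)) = (!) xs ` {0<..<k}"
proof -
  have "set (tl (butlast xs)) = {xs ! Suc i | i. i < k - 1}"
    using assms by (auto simp: set_conv_nth nth_tl nth_butlast) (force simp: nth_tl nth_butlast)+
  also have "\<dots> = (!) xs ` {0<..<k}"
    by (auto simp: image_iff gr0_conv_Suc) force+
  finally show ?thesis .
qed

text \<open>
  Cover the set by the choices of positions \<open>i\<close> in \<open>xs\<close> and \<open>j\<close> in \<open>ys\<close> of a shared inner vertex.
  Each choice prescribes three entries of \<open>ys\<close>: its two ends and the one at position \<open>j\<close>.
\<close>

lemma card_crossing_le:
  assumes "simple_graph G" "xs \<in> path_lists G (Suc k)"
  shows "card {ys \<in> path_lists G (Suc k). hd xs = hd ys \<and> last xs = last ys \<and> crossing xs ys}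
    \<le> k\<^sup>2 * card (verts G) ^ (k - 2)"
proof -
  let ?I = "{0<..<k} \<times> {0<..<k}"
  let ?L = "\<lambda>(i, j). {ys. length ys = Suc k \<and> set ys \<subseteq> verts G \<and>
    ys ! 0 = hd xs \<and> ys ! j = xs ! i \<and> ys ! k = last xs}"
  have V: "finite (verts G)" using assms(1) by (simp add: simple_graph_def)
  have len: "length xs = Suc k" using assms(2) by (simp add: path_lists_def)
  have fin: "finite (?L p)" for p
    by (rule finite_subset[OF _ finite_lists_length_eq[OF V, of "Suc k"]]) (auto split: prod.splits)
  have "card {ys \<in> path_lists G (Suc k). hd xs = hd ys \<and> last xs = last ys \<and> crossing xs ys}
      \<le> card (\<Union>p\<in>?I. ?L p)"
  proof (intro card_mono subsetI)
    fix ys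
    assume "ys \<in> {ys \<in> path_lists G (Suc k). hd xs = hd ys \<and> last xs = last ys \<and> crossing xs ys}"
    then have ys: "length ys = Suc k" "set ys \<subseteq> verts G" "hd xs = hd ys" "last xs = last ys"
        "crossing xs ys"
      by (auto simp: path_lists_def)
    obtain i j where "i \<in> {0<..<k}" "j \<in> {0<..<k}" "ys ! j = xs ! i"
      using ys(5) unfolding crossing_def set_tl_butlast[OF len] set_tl_butlast[OF ys(1)] by force
    moreover have "ys ! 0 = hd ys" "ys ! k = last ys"
      using ys(1) by (subst hd_conv_nth last_conv_nth; force)+
    ultimately show "ys \<in> (\<Union>p\<in>?I. ?L p)"
      using ys by (intro UN_I[of "(i, j)"]) auto
  qed (use fin in auto)
  also have "\<dots> \<le> (\<Sum>p\<in>?I. card (?L p))"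
    by (intro card_UN_le) auto
  also have "\<dots> \<le> (\<Sum>p\<in>?I. card (verts G) ^ (k - 2))"
    using V by (intro sum_mono) (auto intro!: card_lists_three_prescribed_le)
  also have "\<dots> = (k - 1)\<^sup>2 * card (verts G) ^ (k - 2)"
    by (simp add: card_cartesian_product power2_eq_square)
  also have "\<dots> \<le> k\<^sup>2 * card (verts G) ^ (k - 2)"
    by (intro mult_right_mono power_mono) auto
  finally show ?thesis .
qed

text \<open>
  Follow \<open>xs\<close> to the common last vertex and return through the inner vertices of \<open>ys\<close>. As \<open>k \<ge> 2\<close>,
  there is at least one of them, and the one next to the common first vertex closes the cycle.
\<close>

lemma glue_in_cycle_lists:
  assumes "xs \<in> path_lists G (Suc k)" "ys \<in> path_lists G (Suc k)" "k \<ge> 2"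
    and "hd xs = hd ys" "last xs = last ys" "\<not> crossing xs ys"
  shows "xs @ rev (tl (butlast ys)) \<in> cycle_lists G (2 * k)"
proof -
  have split: "\<exists>u zs v. ws = u # zs @ [v] \<and> length zs = k - 1" if ws: "length ws = Suc k" for ws :: "'a list"
  proof -
    obtain u ws' where "ws = u # ws'" "length ws' = k" using ws by (cases ws) auto
    then show ?thesis using assms(3) by (cases ws' rule: rev_cases) auto
  qed
  obtain u as v where x: "xs = u # as @ [v]" "length as = k - 1"
    using split[of xs] assms(1) by (auto simp: path_lists_def)
  obtain u' bs v' where "ys = u' # bs @ [v']" "length bs = k - 1"
    using split[of ys] assms(2) by (auto simp: path_lists_def)
  then have y: "ys = u # bs @ [v]" "length bs = k - 1" using assms(4,5) x by auto
  have ne: "bs \<noteq> []" using y(2) assms(3) by auto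
  have "successively (\<lambda>u v. {u, v} \<in> edges G) (bs @ [v])" "{u, hd bs} \<in> edges G"
    using assms(2) ne by (simp_all add: path_lists_def y successively_Cons)
  then have bs: "successively (\<lambda>u v. {u, v} \<in> edges G) bs" "{v, last bs} \<in> edges G"
      "{hd bs, u} \<in> edges G"
    using ne by (simp_all add: successively_append_iff insert_commute)
  have "successively (\<lambda>u v. {v, u} \<in> edges G) bs"
    using bs(1) by (simp add: insert_commute)
  then have "successively (\<lambda>u v. {u, v} \<in> edges G) (xs @ rev bs)"
    using assms(1) bs(2) ne x(1) unfolding successively_append_iff
    by (simp add: path_lists_def hd_rev)
  moreover have "set as \<inter> set bs = {}"
    using assms(6) by (simp add: crossing_def x y butlast_append)
  then have "distinct (xs @ rev bs)"
    using assms(1,2) by (auto simp: path_lists_def x y)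
  moreover have "{last (xs @ rev bs), hd (xs @ rev bs)} \<in> edges G"
    using bs(3) ne x(1) by (simp add: last_rev)
  moreover have "length (xs @ rev bs) = 2 * k" "set (xs @ rev bs) \<subseteq> verts G"
    using assms(1-3) x y by (auto simp: path_lists_def)
  ultimately have "xs @ rev bs \<in> cycle_lists G (2 * k)"
    by (simp add: cycle_lists_def path_lists_def)
  moreover have "tl (butlast ys) = bs"
    by (simp add: y butlast_append)
  ultimately show ?thesis by simp
qed

text \<open>
  Gluing is injective: the first \<open>k + 1\<close> entries of the cycle are \<open>xs\<close>, the others are the inner
  vertices of \<open>ys\<close>, and the ends of \<open>ys\<close> are those of \<open>xs\<close>.
\<close>

lemma card_noncrossing_le:
  assumes "simple_graph G" "k \<ge> 2"
  shows "card {(xs, ys) \<in> path_lists G (Suc k) \<times> path_lists G (Suc k).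
      hd xs = hd ys \<and> last xs = last ys \<and> \<not> crossing xs ys} \<le> card (cycle_lists G (2 * k))"
proof (rule card_inj_on_le)
  let ?D = "{(xs, ys) \<in> path_lists G (Suc k) \<times> path_lists G (Suc k).
      hd xs = hd ys \<and> last xs = last ys \<and> \<not> crossing xs ys}"
  show "(\<lambda>(xs, ys). xs @ rev (tl (butlast ys))) ` ?D \<subseteq> cycle_lists G (2 * k)"
    by (auto intro!: glue_in_cycle_lists assms(2))
  have recover: "ys = hd ys # tl (butlast ys) @ [last ys]" if "length ys = Suc k" for ys :: "'a list"
  proof -
    have "ys \<noteq> []" "butlast ys \<noteq> []" using that assms(2) by (auto simp flip: length_0_conv)
    then have "ys = butlast ys @ [last ys]" "butlast ys = hd (butlast ys) # tl (butlast ys)"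
      "hd (butlast ys) = hd ys"
      by (simp_all, metis append_butlast_last_id hd_append2)
    then show ?thesis by (metis append_Cons)
  qed
  show "inj_on (\<lambda>(xs, ys). xs @ rev (tl (butlast ys))) ?D"
  proof (rule inj_onI, clarify, intro conjI)
    fix xs ys xs' ys'
    assume *: "xs \<in> path_lists G (Suc k)" "ys \<in> path_lists G (Suc k)"
        "xs' \<in> path_lists G (Suc k)" "ys' \<in> path_lists G (Suc k)"
        "hd xs = hd ys" "last xs = last ys" "hd xs' = hd ys'" "last xs' = last ys'"
        "xs @ rev (tl (butlast ys)) = xs' @ rev (tl (butlast ys'))"
    then have "xs = xs'" "tl (butlast ys) = tl (butlast ys')"
      by (auto simp: path_lists_def)
    moreover from this have "ys = ys'"
      using * recover[of ys] recover[of ys'] by (simp add: path_lists_def)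
    ultimately show "xs = xs'" "ys = ys'" by auto
  qed
qed (rule finite_cycle_lists[OF assms(1)])

section \<open>The counting inequality\<close>

text \<open>
  The pairs of paths with common ends, split into the disjoint ones, which are bounded by the number of
  cycles, and the crossing ones. The inequality is the Cauchy--Schwarz bound multiplied by \<open>n\<^sup>2\<close>, to
  stay within the natural numbers.
\<close>

lemma num_copies_even_cycle_ge:
  assumes "simple_graph G" "k \<ge> 2"
  defines "n \<equiv> card (verts G)" and "w \<equiv> card (path_lists G (Suc k))"
  shows "w\<^sup>2 \<le> 4 * k * n\<^sup>2 * num_copies (cycle_graph (2 * k)) G + k\<^sup>2 * n ^ k * w"
proof -
  let ?W = "path_lists G (Suc k)"
  let ?V = "verts G"
  let ?E = "{(xs, ys) \<in> ?W \<times> ?W. (hd xs, last xs) = (hd ys, last ys)}"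
  let ?N = "{(xs, ys) \<in> ?W \<times> ?W. hd xs = hd ys \<and> last xs = last ys \<and> \<not> crossing xs ys}"
  let ?X = "SIGMA xs:?W. {ys \<in> ?W. hd xs = hd ys \<and> last xs = last ys \<and> crossing xs ys}"
  have W: "finite ?W" by (rule finite_path_lists[OF assms(1)])
  have V: "finite ?V" using assms(1) by (simp add: simple_graph_def)
  have "(\<lambda>xs. (hd xs, last xs)) ` ?W \<subseteq> ?V \<times> ?V"
    by (fastforce simp: path_lists_def simp flip: length_greater_0_conv)
  then have "w\<^sup>2 \<le> card (?V \<times> ?V) * card ?E"
    unfolding w_def using W V by (intro card_squared_le_card_collisions) auto
  also have "card (?V \<times> ?V) = n\<^sup>2"
    by (simp add: n_def card_cartesian_product power2_eq_square)
  also have "card ?E \<le> card ?N + card ?X"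
  proof -
    have "?E = ?N \<union> ?X" by auto
    then show ?thesis using card_Un_le[of ?N ?X] by simp
  qed
  also have "card ?N \<le> 4 * k * num_copies (cycle_graph (2 * k)) G"
    using card_noncrossing_le[OF assms(1,2)] card_cycle_lists_le[OF assms(1), of "2 * k"] assms(2)
    by simp
  also have "card ?X \<le> w * (k\<^sup>2 * n ^ (k - 2))"
  proof -
    have "card ?X = (\<Sum>xs\<in>?W. card {ys \<in> ?W. hd xs = hd ys \<and> last xs = last ys \<and> crossing xs ys})"
      using W by (intro card_SigmaI) auto
    also have "\<dots> \<le> (\<Sum>xs\<in>?W. k\<^sup>2 * n ^ (k - 2))"
      unfolding n_def by (intro sum_mono card_crossing_le assms(1))
    finally show ?thesis by (simp add: w_def)
  qed
  finally have "w\<^sup>2 \<le> n\<^sup>2 * (4 * k * num_copies (cycle_graph (2 * k)) G + w * (k\<^sup>2 * n ^ (k - 2)))"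
    by simp
  also have "\<dots> = 4 * k * n\<^sup>2 * num_copies (cycle_graph (2 * k)) G + k\<^sup>2 * (n\<^sup>2 * n ^ (k - 2)) * w"
    by (simp add: algebra_simps)
  also have "n\<^sup>2 * n ^ (k - 2) = n ^ k"
    using assms(2) by (simp only: power_add[symmetric] le_add_diff_inverse)
  finally show ?thesis .
qed

text \<open>
  The previous inequality says that \<open>w (w - k\<^sup>2 n\<^sup>k)\<close> is at most \<open>4 k n\<^sup>2\<close> times the number of cycles.
  Once \<open>2 m \<ge> k\<^sup>2 n\<^sup>k\<close>, the left-hand side increases in \<open>w \<ge> 2 m\<close>, so that \<open>w\<close> may be replaced by \<open>2 m\<close>.
  This matters because a graph may have more copies of the path than required.
\<close>

lemma num_copies_even_cycle_lower_bound:
  assumes "simple_graph G" "k \<ge> 2" "card (verts G) = n" "n > 0" "m > 0"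
    and "m \<le> num_copies (path_graph (k + 1)) G" "k\<^sup>2 * n ^ k \<le> 2 * m"
  shows "real (num_copies (cycle_graph (2 * k)) G)
    \<ge> (1 / real k - real k / 2 * (real n ^ k / real m)) * (real m / real n)\<^sup>2"
proof -
  let ?N = "real (num_copies (cycle_graph (2 * k)) G)"
  define w where "w = real (card (path_lists G (Suc k)))"
  define c where "c = real k ^ 2 * real n ^ k"
  have "real (2 * m) \<le> w"
    using two_num_copies_path_le[OF assms(1), of "Suc k"] assms(2,6)
    unfolding w_def of_nat_le_iff by simp
  then have w: "2 * real m \<le> w" by simp
  have "real (k\<^sup>2 * n ^ k) \<le> real (2 * m)"
    using assms(7) by (simp only: of_nat_le_iff)
  then have c: "c \<le> 2 * real m" by (simp add: c_def)
  have "real ((card (path_lists G (Suc k)))\<^sup>2)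
      \<le> real (4 * k * n\<^sup>2 * num_copies (cycle_graph (2 * k)) G + k\<^sup>2 * n ^ k * card (path_lists G (Suc k)))"
    using num_copies_even_cycle_ge[OF assms(1,2)] assms(3) by (simp only: of_nat_le_iff)
  then have main: "w * (w - c) \<le> 4 * real k * (real n)\<^sup>2 * ?N"
    by (simp add: w_def c_def power2_eq_square algebra_simps)
  have "2 * real m * (2 * real m - c) \<le> w * (w - c)"
    using w c by (intro mult_mono) auto
  with main have "2 * real m * (2 * real m - c) \<le> 4 * real k * (real n)\<^sup>2 * ?N" by linarith
  moreover have "4 * real k * (real n)\<^sup>2 *
      ((1 / real k - real k / 2 * (real n ^ k / real m)) * (real m / real n)\<^sup>2)
      = 2 * real m * (2 * real m - c)"
    using assms(2,4,5) by (simp add: c_def field_simps power2_eq_square)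
  ultimately have "4 * real k * (real n)\<^sup>2 *
      ((1 / real k - real k / 2 * (real n ^ k / real m)) * (real m / real n)\<^sup>2)
      \<le> 4 * real k * (real n)\<^sup>2 * ?N" by linarith
  moreover have "0 < 4 * real k * (real n)\<^sup>2"
    using assms(2,4) by simp
  ultimately show ?thesis by (simp only: mult_le_cancel_left_pos)
qed

theorem theorem6p1:
  fixes k :: nat and m :: "nat \<Rightarrow> nat"
  assumes "k > 2"
    and "filterlim (\<lambda>n. real (m n) / real n ^ k) at_top sequentially"
  shows "\<exists>\<epsilon> :: nat \<Rightarrow> real. \<epsilon> \<in> o(\<lambda>_. 1) \<and>
    (\<forall>\<^sub>F n in sequentially.
       satex_hosts n (path_graph (k + 1)) (m n) \<noteq> {} \<longrightarrow>
       real (satex n (path_graph (k + 1)) (m n) (cycle_graph (2 * k)))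
         \<ge> (1 / real k - \<epsilon> n) * (real (m n) / real n)\<^sup>2)"
proof -
  \<comment> \<open>The explicit error term of the bound for a single graph.\<close>
  let ?\<epsilon> = "\<lambda>n. real k / 2 * (real n ^ k / real (m n))"
  have "((\<lambda>n. inverse (real (m n) / real n ^ k)) \<longlongrightarrow> 0) sequentially"
    by (rule tendsto_inverse_0_at_top[OF assms(2)])
  then have "((\<lambda>n. real k / 2 * inverse (real (m n) / real n ^ k)) \<longlongrightarrow> real k / 2 * 0) sequentially"
    by (intro tendsto_intros)
  then have small: "?\<epsilon> \<in> o(\<lambda>_. 1)"
    by (intro smalloI_tendsto) (simp_all add: field_simps)
  have "eventually (\<lambda>n. real (m n) / real n ^ k \<ge> max 1 ((real k)\<^sup>2)) sequentially"
    using assms(2) unfolding filterlim_at_top by blast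
  then have "\<forall>\<^sub>F n in sequentially.
       satex_hosts n (path_graph (k + 1)) (m n) \<noteq> {} \<longrightarrow>
       real (satex n (path_graph (k + 1)) (m n) (cycle_graph (2 * k)))
         \<ge> (1 / real k - ?\<epsilon> n) * (real (m n) / real n)\<^sup>2"
    using eventually_gt_at_top[of 0]
  proof eventually_elim
    case (elim n)
    then have m: "real (m n) \<ge> 1 * real n ^ k" "real (m n) \<ge> (real k)\<^sup>2 * real n ^ k"
      by (simp_all add: field_simps)
    have "0 < real n ^ k" using elim by simp
    then have "0 < real (m n)" using m(1) by linarith
    then have "m n > 0" by simp
    have "real (k\<^sup>2 * n ^ k) \<le> real (m n)" using m by simp
    then have large: "k\<^sup>2 * n ^ k \<le> 2 * m n" unfolding of_nat_le_iff by linarith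
    show ?case
    proof
      assume "satex_hosts n (path_graph (k + 1)) (m n) \<noteq> {}"
      from satex_attained[OF this, of "cycle_graph (2 * k)"]
      obtain H where host: "H \<in> satex_hosts n (path_graph (k + 1)) (m n)"
        and min: "satex n (path_graph (k + 1)) (m n) (cycle_graph (2 * k))
          = num_copies (cycle_graph (2 * k)) H" ..
      have H: "simple_graph H" "card (verts H) = n" "m n \<le> num_copies (path_graph (k + 1)) H"
        using host by (simp_all add: satex_hosts_def)
      show "real (satex n (path_graph (k + 1)) (m n) (cycle_graph (2 * k)))
         \<ge> (1 / real k - ?\<epsilon> n) * (real (m n) / real n)\<^sup>2"
        unfolding min
        using num_copies_even_cycle_lower_bound[OF H(1) _ H(2) _ \<open>m n > 0\<close> H(3) large] elim assms(1)
        by simp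
    qed
  qed
  with small show ?thesis by (intro exI[of _ ?\<epsilon>] conjI)
qed

end
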